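(* Let $t\ge5$ be an integer. Then there exists a finite set $A\subset\mathbb{N}$ with $|A|=t$ such that $3(t-1)<n(A)$. Moreover, there exists a far-flung Gorenstein numerical semigroup $S$ with $s(S)=t(S)=t$ such that $\mathrm{res}(S)>\ell(S)$.
   Context: $\mathbb{N}$ denotes the non-negative integers. For integers $x\le y$, $[x,y]=\{z\in\mathbb{Z}\mid x\le z\le y\}$. For sets of integers, $A+B=\{a+b\mid a\in A,b\in B\}$ and $I-J=\{z\in\mathbb{Z}\mid z+y\in I\text{ for all }y\in J\}$ (set difference is written $\setminus$). A numerical semigroup is a submonoid $S$ of $(\mathbb{N},+)$ with $\mathbb{N}\setminus S$ finite. Its multiplicity $m(S)$ is the smallest element of $S\setminus\{0\}$; its Frobenius number $F(S)$ is the largest integer in $\mathbb{Z}\setminus S$. $PF(S)=\{x\in\mathbb{Z}\setminus S\mid x+s\in S\text{ for all }0\ne s\in S\}$, and the type is $t(S)=|PF(S)|$. Put $rPF(S)=[F(S)-m(S)+1,F(S)]\setminus S$; the reduced type is $s(S)=|rPF(S)|$. Let $C(S)=\{z\in\mathbb{Z}\mid z\ge F(S)+1\}$, $K(S)=\{x\in\mathbb{Z}\mid F(S)-x\notin S\}$, and $\mathrm{tr}(K(S))=K(S)+(S-K(S))$. $S$ is far-flung Gorenstein if $\mathrm{tr}(K(S))=C(S)$. Put $\mathrm{res}(S)=|S\setminus\mathrm{tr}(K(S))|$ and $\ell(S)=|K(S)\setminus S|$. For a finite set $A\subset\mathbb{N}$ with $0\in A$, $n(A)$ is the integer such that $0,1,\dots,n(A)-1\in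 A+A$ and $n(A)\notin A+A$; if $0\notin A$, $n(A)=-1$. *)

theory Defs
  imports Main "HOL-Library.Set_Algebras"
begin

text \<open>
  Numerical semigroups are represented as sets of integers contained in
  \<open>{0..}\<close>, since the fractional ideals attached to them live in the integers.
  On sets, \<open>+\<close> is the elementwise sum of \<open>HOL-Library.Set_Algebras\<close>, whereas
  \<open>-\<close> is set difference; the ideal quotient is written \<open>ideal_quot\<close>.
\<close>

definition numerical_semigroup :: "int set \<Rightarrow> bool" where
  "numerical_semigroup S \<longleftrightarrow>
     S \<subseteq> {0..} \<and> 0 \<in> S \<and> (\<forall>x\<in>S. \<forall>y\<in>S. x + y \<in> S) \<and> finite ({0..} - S)"

definition ideal_quot :: "int set \<Rightarrow> int set \<Rightarrow> int set" where
  "ideal_quot I J = {z. \<forall>y\<in>J. z + y \<in> I}"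

definition multiplicity :: "int set \<Rightarrow> int" where
  "multiplicity S = (LEAST x. x \<in> S - {0})"

definition frobenius :: "int set \<Rightarrow> int" where
  "frobenius S = (GREATEST x. x \<notin> S)"

definition pseudo_frobenius :: "int set \<Rightarrow> int set" where
  "pseudo_frobenius S = {x. x \<notin> S \<and> (\<forall>s\<in>S. s \<noteq> 0 \<longrightarrow> x + s \<in> S)}"

definition semigroup_type :: "int set \<Rightarrow> nat" where
  "semigroup_type S = card (pseudo_frobenius S)"

definition reduced_pseudo_frobenius :: "int set \<Rightarrow> int set" where
  "reduced_pseudo_frobenius S = {frobenius S - multiplicity S + 1 .. frobenius S} - S"

definition reduced_type :: "int set \<Rightarrow> nat" where
  "reduced_type S = card (reduced_pseudo_frobenius S)"

definition conductor :: "int set \<Rightarrow> int set" where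
  "conductor S = {z. z \<ge> frobenius S + 1}"

definition canonical_ideal :: "int set \<Rightarrow> int set" where
  "canonical_ideal S = {x. frobenius S - x \<notin> S}"

definition canonical_trace :: "int set \<Rightarrow> int set" where
  "canonical_trace S = canonical_ideal S + ideal_quot S (canonical_ideal S)"

definition far_flung_gorenstein :: "int set \<Rightarrow> bool" where
  "far_flung_gorenstein S \<longleftrightarrow> canonical_trace S = conductor S"

definition residue :: "int set \<Rightarrow> nat" where
  "residue S = card (S - canonical_trace S)"

definition canonical_length :: "int set \<Rightarrow> nat" where
  "canonical_length S = card (canonical_ideal S - S)"

text \<open>
  For finite \<open>A\<close> containing 0, the description below determines a unique \<open>n\<close>,
  namely the least natural number that is not a sum of two elements of \<open>A\<close>.
\<close>

definition sumset_bound :: "nat set \<Rightarrow> int" where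
  "sumset_bound A =
     (if 0 \<in> A then int (THE n. (\<forall>k<n. k \<in> A + A) \<and> n \<notin> A + A) else - 1)"

end

theory Submission
  imports Defs
begin

text \<open>
  The set \<open>A = {0, 1, 3, 5, \<dots>, 2t - 5, 2t - 4}\<close> has \<open>t\<close> elements and
  \<open>A + A = [0, 4t - 8]\<close>, which contains \<open>[0, 3t - 3]\<close> as soon as \<open>t \<ge> 5\<close>.

  Put \<open>m = 3t - 2\<close> and \<open>F = 2m - 1\<close>, and let \<open>S\<close> consist of \<open>0\<close> and all integers
  \<open>x \<ge> m\<close> not in \<open>F - A\<close>. It is a semigroup because sums of two non-zero elements exceed \<open>F\<close>.
  The gaps in the top window \<open>[m, F]\<close> form \<open>F - A\<close>, and they are all the pseudo-Frobenius
  numbers, because every \<open>x \<in> A\<close>, \<open>x \<noteq> 0\<close>, can be shifted by an element of \<open>A\<close>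
  into \<open>[0, m - 1]\<close> outside \<open>A\<close>. As \<open>A \<subseteq> K(S)\<close>, the inclusion
  \<open>[0, m - 1] \<subseteq> A + A\<close> makes \<open>S\<close> far-flung Gorenstein. Finally
  \<open>res(S) = m - t + 1 = 2t - 1\<close>, whereas \<open>K(S) \ S\<close> consists of \<open>A \ {0}\<close> and
  its mirror image under \<open>x \<mapsto> F - x\<close>, so that \<open>\<ell>(S) = 2t - 2\<close>.
\<close>

section \<open>Lower bounds for \<open>sumset_bound\<close>\<close>

lemma less_sumset_bound:
  fixes A :: "nat set"
  assumes fin: "finite A" and zero: "0 \<in> A" and le: "\<And>k. k \<le> N \<Longrightarrow> k \<in> A + A"
  shows "int N < sumset_bound A"
proof -
  \<comment> \<open>Finiteness of \<open>A + A\<close> is what makes the \<open>THE\<close> in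
    \<open>sumset_bound\<close> well defined.\<close>
  have "\<exists>n. n \<notin> A + A"
    using finite_set_plus[OF fin fin] ex_new_if_finite infinite_UNIV_nat by blast
  then obtain n where n: "n \<notin> A + A" "\<forall>k<n. k \<in> A + A"
    using exists_least_iff[of "\<lambda>n. n \<notin> A + A"] by blast
  have "(THE n. (\<forall>k<n. k \<in> A + A) \<and> n \<notin> A + A) = n"
    using n by (intro the_equality) (auto intro: linorder_neqE_nat)
  moreover have "N < n"
    using n le by (meson not_le)
  ultimately show ?thesis
    using zero by (simp add: sumset_bound_def)
qed

section \<open>Semigroups whose top gaps mirror an additive basis\<close>

locale window_basis =
  fixes A :: "int set" and m :: int
  assumes zero_mem: "0 \<in> A"
    and subset: "A \<subseteq> {0..m - 2}"
    and basis: "\<And>x. 0 \<le> x \<Longrightarrow> x < m \<Longrightarrow> \<exists>a\<in>A. \<exists>b\<in>A. x = a + b"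
    and shift: "\<And>x. x \<in> A \<Longrightarrow> x \<noteq> 0 \<Longrightarrow> \<exists>a\<in>A. a + x < m \<and> a + x \<notin> A"
begin

definition S :: "int set" where
  "S = {0} \<union> {x. m \<le> x \<and> 2 * m - 1 - x \<notin> A}"

lemma A_bounds: "a \<in> A \<Longrightarrow> 0 \<le> a \<and> a \<le> m - 2"
  using subset by auto

lemma m_ge_2: "2 \<le> m"
  using A_bounds[OF zero_mem] by simp

lemma finite_A: "finite A"
  using subset finite_subset by blast

lemma S_cases: "x \<in> S \<longleftrightarrow> x = 0 \<or> m \<le> x \<and> 2 * m - 1 - x \<notin> A"
  by (auto simp: S_def)

lemma large_mem_S: "2 * m \<le> x \<Longrightarrow> x \<in> S"
  using A_bounds[of "2 * m - 1 - x"] m_ge_2 by (auto simp: S_cases)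

lemma numerical_semigroup_S: "numerical_semigroup S"
proof -
  have "x + y \<in> S" if "x \<in> S" "y \<in> S" for x y
    using that large_mem_S[of "x + y"] S_cases[of x] S_cases[of y] by auto
  moreover have "{0..} - S \<subseteq> {0..2 * m}"
  proof
    show "x \<in> {0..2 * m}" if "x \<in> {0..} - S" for x
      using that large_mem_S[of x] by (cases "2 * m \<le> x") auto
  qed
  then have "finite ({0..} - S)"
    using finite_subset by blast
  ultimately show ?thesis
    using m_ge_2 by (auto simp: numerical_semigroup_def S_cases)
qed

lemma multiplicity_S: "multiplicity S = m"
  unfolding multiplicity_def
proof (rule Least_equality)
  \<comment> \<open>The mirror image of \<open>m\<close> is \<open>m - 1\<close>, just above the
    bound \<open>m - 2\<close> on \<open>A\<close>.\<close>
  show "m \<in> S - {0}"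
    using m_ge_2 A_bounds[of "m - 1"] by (auto simp: S_cases)
qed (auto simp: S_cases)

lemma frobenius_S: "frobenius S = 2 * m - 1"
  unfolding frobenius_def
proof (rule Greatest_equality)
  show "2 * m - 1 \<notin> S"
    using zero_mem m_ge_2 by (auto simp: S_cases)
  show "x \<le> 2 * m - 1" if "x \<notin> S" for x
    using large_mem_S[of x] that by linarith
qed

lemma mem_reflected_A: "x \<in> (\<lambda>a. 2 * m - 1 - a) ` B \<longleftrightarrow> 2 * m - 1 - x \<in> B"
  by (auto intro: rev_image_eqI)

lemma reduced_pseudo_frobenius_S: "reduced_pseudo_frobenius S = (\<lambda>a. 2 * m - 1 - a) ` A"
  using m_ge_2 A_bounds[of "2 * m - 1"]
  by (auto simp: reduced_pseudo_frobenius_def multiplicity_S frobenius_S S_cases mem_reflected_A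
      dest: A_bounds)

lemma pseudo_frobenius_S: "pseudo_frobenius S = (\<lambda>a. 2 * m - 1 - a) ` A"
proof (rule set_eqI, rule iffI)
  fix x assume "x \<in> pseudo_frobenius S"
  then have x: "x \<notin> S" and x_add: "\<And>s. s \<in> S \<Longrightarrow> s \<noteq> 0 \<Longrightarrow> x + s \<in> S"
    by (auto simp: pseudo_frobenius_def)
  have "m \<le> x"
  proof (rule ccontr)
    assume "\<not> m \<le> x"
    have "x \<noteq> 0"
      using x by (auto simp: S_cases)
    have "0 < x"
    proof (rule ccontr)
      assume "\<not> 0 < x"
      \<comment> \<open>A negative \<open>x\<close> would carry this element of \<open>S\<close> to
        the gap \<open>2 * m - 1\<close>.\<close>
      then have "2 * m - 1 - x \<in> S"
        using \<open>x \<noteq> 0\<close> large_mem_S by simp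
      then have "2 * m - 1 \<in> S"
        using x_add[of "2 * m - 1 - x"] \<open>\<not> 0 < x\<close> m_ge_2 by simp
      then show False
        using zero_mem m_ge_2 by (simp add: S_cases)
    qed
    \<comment> \<open>Take \<open>a = 0\<close> if \<open>x \<notin> A\<close>, and use
      \<open>shift\<close> otherwise. Then \<open>x\<close> carries the element
      \<open>2 * m - 1 - (a + x)\<close> of \<open>S\<close> to the gap
      \<open>2 * m - 1 - a\<close>.\<close>
    obtain a where a: "a \<in> A" "a + x < m" "a + x \<notin> A"
      using shift[of x] zero_mem \<open>\<not> m \<le> x\<close> \<open>x \<noteq> 0\<close> by (cases "x \<in> A") force+
    have "2 * m - 1 - (a + x) \<in> S"
      using a by (auto simp: S_cases)
    then have "x + (2 * m - 1 - (a + x)) \<in> S"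
      using x_add a m_ge_2 by force
    then show False
      using a A_bounds[of a] m_ge_2 by (auto simp: S_cases)
  qed
  then have "2 * m - 1 - x \<in> A"
    using x by (auto simp: S_cases)
  then show "x \<in> (\<lambda>a. 2 * m - 1 - a) ` A"
    by (simp only: mem_reflected_A)
next
  fix x assume "x \<in> (\<lambda>a. 2 * m - 1 - a) ` A"
  then obtain a where a: "a \<in> A" "x = 2 * m - 1 - a"
    by auto
  then have "x \<notin> S"
    using A_bounds[of a] m_ge_2 by (auto simp: S_cases)
  moreover have "x + s \<in> S" if "s \<in> S" "s \<noteq> 0" for s
    using that a A_bounds[of a] S_cases[of s] by (intro large_mem_S) auto
  ultimately show "x \<in> pseudo_frobenius S"
    by (auto simp: pseudo_frobenius_def)
qed

lemma card_reflected_A: "card ((\<lambda>a. 2 * m - 1 - a) ` B) = card B"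
  by (rule card_image) (auto simp: inj_on_def)

text \<open>For \<open>x < m\<close> the mirror image is at least \<open>m\<close>, so it is a gap
  exactly when \<open>x \<in> A\<close>. For \<open>x \<ge> m\<close> it lies below
  \<open>m\<close>, where \<open>0\<close> is the only element of \<open>S\<close>.\<close>

lemma canonical_ideal_S:
  "canonical_ideal S = A \<union> ({m..} - {2 * m - 1})"
  using A_bounds m_ge_2
  by (fastforce simp: canonical_ideal_def frobenius_S S_cases)

text \<open>As the canonical ideal contains \<open>0\<close> and no negative numbers, it suffices
  that the quotient consists of the integers from \<open>2 * m\<close> on.\<close>

lemma canonical_trace_S: "canonical_trace S = conductor S"
proof (rule set_eqI, rule iffI)
  fix x assume "x \<in> canonical_trace S"
  then obtain k z where x: "x = k + z" and k: "k \<in> canonical_ideal S"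
    and z: "\<And>y. y \<in> canonical_ideal S \<Longrightarrow> z + y \<in> S"
    by (auto simp: canonical_trace_def ideal_quot_def elim: set_plus_elim)
  have k0: "0 \<le> k"
    using k A_bounds m_ge_2 by (fastforce simp: canonical_ideal_S)
  have zA: "z + a \<in> S" if "a \<in> A" for a
    using z that by (simp add: canonical_ideal_S)
  have "z \<in> S"
    using zA[OF zero_mem] by simp
  have "2 * m \<le> z"
  proof (rule ccontr)
    assume small: "\<not> 2 * m \<le> z"
    show False
    proof (cases "z = 0")
      case True
      \<comment> \<open>Representing \<open>1\<close> yields a nonzero \<open>c \<in> A\<close>; it
        lies in the canonical ideal but not in \<open>S\<close>, which rules out
        \<open>z = 0\<close>.\<close>
      obtain a b where "a \<in> A" "b \<in> A" "1 = a + b"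
        using basis[of 1] m_ge_2 by auto
      then obtain c where "c \<in> A" "c \<noteq> 0"
        by (metis add_0 zero_neq_one)
      then show False
        using zA[of c] True A_bounds[of c] by (auto simp: S_cases)
    next
      case False
      then have "m \<le> z" "z \<le> 2 * m - 1"
        using \<open>z \<in> S\<close> small by (auto simp: S_cases)
      \<comment> \<open>Adding the element \<open>b\<close> of the canonical ideal to
        \<open>z\<close> gives the gap \<open>2 * m - 1 - a\<close>.\<close>
      then obtain a b where "a \<in> A" "b \<in> A" "2 * m - 1 - z = a + b"
        using basis[of "2 * m - 1 - z"] by auto
      moreover from this have "2 * m - 1 - (z + b) = a"
        by simp
      ultimately show False
        using zA[of b] \<open>m \<le> z\<close> m_ge_2 A_bounds[of b] by (auto simp: S_cases)
    qed
  qed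
  then show "x \<in> conductor S"
    using x k0 by (simp add: conductor_def frobenius_S)
next
  fix x assume "x \<in> conductor S"
  then have "2 * m \<le> x"
    by (simp add: conductor_def frobenius_S)
  then have "x + y \<in> S" if "y \<in> canonical_ideal S" for y
    using that A_bounds[of y] m_ge_2 by (intro large_mem_S) (auto simp: canonical_ideal_S)
  then have "0 + x \<in> canonical_trace S"
    unfolding canonical_trace_def
    by (intro set_plus_intro) (auto simp: ideal_quot_def canonical_ideal_S zero_mem)
  then show "x \<in> canonical_trace S"
    by simp
qed

lemma residue_S: "int (residue S) = m - int (card A) + 1"
proof -
  let ?r = "\<lambda>a. 2 * m - 1 - a"
  have "S - canonical_trace S = insert 0 ({m..2 * m - 1} - ?r ` A)"
    using m_ge_2 mem_reflected_A
    by (auto simp: canonical_trace_S conductor_def frobenius_S S_cases)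
  moreover have "?r ` A \<subseteq> {m..2 * m - 1}"
    using A_bounds by force
  then have "int (card ({m..2 * m - 1} - ?r ` A)) = m - int (card A)"
    using finite_A card_mono[of "{m..2 * m - 1}" "?r ` A"] m_ge_2
    by (simp add: card_Diff_subset card_reflected_A of_nat_diff)
  ultimately show ?thesis
    using m_ge_2 by (simp add: residue_def)
qed

lemma canonical_length_S: "canonical_length S = 2 * (card A - 1)"
proof -
  let ?r = "\<lambda>a. 2 * m - 1 - a"
  \<comment> \<open>\<open>0\<close> drops out as an element of \<open>S\<close>, and its mirror
    image \<open>2 * m - 1\<close> because it is outside the canonical ideal.\<close>
  let ?B = "A - {0}"
  have "canonical_ideal S - S = ?B \<union> ?r ` ?B"
    unfolding set_eq_iff Un_iff mem_reflected_A
    using m_ge_2 by (auto simp: canonical_ideal_S S_cases dest: A_bounds)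
  moreover have "?B \<inter> ?r ` ?B = {}"
    unfolding set_eq_iff Int_iff mem_reflected_A by (auto dest!: A_bounds)
  ultimately show ?thesis
    using finite_A zero_mem
    by (simp add: canonical_length_def card_Un_disjoint card_reflected_A)
qed

end

section \<open>The additive basis of odd numbers and two even ones\<close>

definition odd_basis :: "nat \<Rightarrow> nat set" where
  "odd_basis t = {0, 2 * t - 4} \<union> (\<lambda>i. 2 * i + 1) ` {..<t - 2}"

lemma finite_odd_basis: "finite (odd_basis t)"
  by (simp add: odd_basis_def)

lemma mem_odd_basis:
  "2 \<le> t \<Longrightarrow> x \<in> odd_basis t \<longleftrightarrow> x = 0 \<or> x = 2 * t - 4 \<or> odd x \<and> x < 2 * t - 4"
  by (auto simp: odd_basis_def elim!: oddE)

lemma card_odd_basis: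
  assumes "3 \<le> t"
  shows "card (odd_basis t) = t"
proof -
  have "card ((\<lambda>i::nat. 2 * i + 1) ` {..<t - 2}) = t - 2"
    by (subst card_image) (auto simp: inj_on_def)
  moreover have "2 * t - 4 \<notin> (\<lambda>i::nat. 2 * i + 1) ` {..<t - 2}"
    by auto
  moreover have "0 \<notin> (\<lambda>i::nat. 2 * i + 1) ` {..<t - 2}"
    by auto
  ultimately show ?thesis
    using assms by (simp add: odd_basis_def)
qed

text \<open>Large odd numbers use the even summand \<open>2 * t - 4\<close>. Even numbers other than
  \<open>0\<close> and \<open>4 * t - 8\<close> are sums of two odd elements, one of them
  \<open>1\<close> or \<open>2 * t - 5\<close>.\<close>

lemma odd_basis_sum:
  assumes t: "3 \<le> t" and k: "k \<le> 4 * t - 8"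
  shows "\<exists>a\<in>odd_basis t. \<exists>b\<in>odd_basis t. k = a + b"
proof -
  have mem: "x \<in> odd_basis t \<longleftrightarrow> x = 0 \<or> x = 2 * t - 4 \<or> odd x \<and> x < 2 * t - 4" for x
    using t by (intro mem_odd_basis) simp
  consider "k \<in> odd_basis t" | "odd k" "2 * t - 4 < k" | "k = 4 * t - 8"
    | "even k" "0 < k" "k \<le> 2 * t - 4" | "even k" "2 * t - 4 < k" "k < 4 * t - 8"
    using k mem[of k] by linarith
  then show ?thesis
  proof cases
    case 1
    then show ?thesis
      using mem[of 0] by (metis add_0)
  next
    case 2
    then show ?thesis
      using t k by (intro bexI[of _ "2 * t - 4"] bexI[of _ "k - (2 * t - 4)"])
        (auto simp: mem; presburger)+
  next
    case 3
    then show ?thesis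
      using t by (intro bexI[of _ "2 * t - 4"]) (auto simp: mem)
  next
    case 4
    then show ?thesis
      using t by (intro bexI[of _ 1] bexI[of _ "k - 1"]) (auto simp: mem)
  next
    case 5
    then show ?thesis
      using t by (intro bexI[of _ "2 * t - 5"] bexI[of _ "k - (2 * t - 5)"])
        (auto simp: mem; presburger)+
  qed
qed

lemma odd_basis_window:
  assumes t: "5 \<le> t"
  shows "window_basis (int ` odd_basis t) (3 * int t - 2)"
proof
  have mem: "x \<in> odd_basis t \<longleftrightarrow> x = 0 \<or> x = 2 * t - 4 \<or> odd x \<and> x < 2 * t - 4" for x
    using t by (intro mem_odd_basis) simp
  show "0 \<in> int ` odd_basis t"
    using mem[of 0] by force
  show "int ` odd_basis t \<subseteq> {0..3 * int t - 2 - 2}"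
    using t by (auto simp: mem)
  show "\<exists>a\<in>int ` odd_basis t. \<exists>b\<in>int ` odd_basis t. x = a + b"
    if "0 \<le> x" "x < 3 * int t - 2" for x
  proof -
    have "nat x \<le> 4 * t - 8"
      using that t by linarith
    then obtain a b where "a \<in> odd_basis t" "b \<in> odd_basis t" "nat x = a + b"
      using odd_basis_sum[of t "nat x"] t by auto
    moreover from this have "x = int a + int b"
      using that by linarith
    ultimately show ?thesis
      by blast
  qed
  show "\<exists>a\<in>int ` odd_basis t. a + x < 3 * int t - 2 \<and> a + x \<notin> int ` odd_basis t"
    if "x \<in> int ` odd_basis t" "x \<noteq> 0" for x
  proof -
    from that obtain y where y: "y \<in> odd_basis t" "x = int y" "y \<noteq> 0"
      by auto
    have "\<exists>a\<in>odd_basis t. a + y < 3 * t - 2 \<and> a + y \<notin> odd_basis t"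
    \<comment> \<open>Adding \<open>1\<close> makes an odd \<open>y\<close> even and pushes
      \<open>2 * t - 4\<close> past the maximum. Only \<open>2 * t - 5\<close> would land on
      \<open>2 * t - 4\<close>; adding \<open>3\<close> moves it past the maximum instead.\<close>
    proof (cases "y = 2 * t - 5")
      case True
      then show ?thesis
        using t by (intro bexI[of _ 3]) (auto simp: mem)
    next
      case False
      then have "y + 1 \<noteq> 2 * t - 4"
        by linarith
      then show ?thesis
        using t y by (intro bexI[of _ 1]) (auto simp: mem)
    qed
    then obtain a where a: "a \<in> odd_basis t" "a + y < 3 * t - 2" "a + y \<notin> odd_basis t"
      by blast
    then have "int a + x < 3 * int t - 2" "int a + x \<notin> int ` odd_basis t"
      using y t by (auto simp flip: of_nat_add)
    with a show ?thesis
      by blast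
  qed
qed

theorem theorem3:
  fixes t :: nat
  assumes "t \<ge> 5"
  shows "(\<exists>A :: nat set. finite A \<and> card A = t \<and> 3 * (int t - 1) < sumset_bound A) \<and>
         (\<exists>S :: int set. numerical_semigroup S \<and> far_flung_gorenstein S \<and>
            reduced_type S = t \<and> semigroup_type S = t \<and>
            residue S > canonical_length S)"
proof
  have card: "card (odd_basis t) = t"
    using assms by (simp add: card_odd_basis)
  have "int (3 * (t - 1)) < sumset_bound (odd_basis t)"
  proof (rule less_sumset_bound[OF finite_odd_basis])
    show "0 \<in> odd_basis t"
      by (simp add: odd_basis_def)
    show "k \<in> odd_basis t + odd_basis t" if "k \<le> 3 * (t - 1)" for k
    proof -
      have "k \<le> 4 * t - 8"
        using that assms by linarith
      then show ?thesis
        using odd_basis_sum[of t k] assms by (auto intro: set_plus_intro)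
    qed
  qed
  then have "3 * (int t - 1) < sumset_bound (odd_basis t)"
    using assms by (simp add: of_nat_diff)
  then show "\<exists>A :: nat set. finite A \<and> card A = t \<and> 3 * (int t - 1) < sumset_bound A"
    using finite_odd_basis card by blast
  interpret window_basis "int ` odd_basis t" "3 * int t - 2"
    using assms by (rule odd_basis_window)
  have card_int: "card (int ` odd_basis t) = t"
    using card by (simp add: card_image)
  have "canonical_length S < residue S"
    using residue_S canonical_length_S assms unfolding card_int by linarith
  moreover have "reduced_type S = t" "semigroup_type S = t"
    by (simp_all only: reduced_type_def semigroup_type_def reduced_pseudo_frobenius_S
        pseudo_frobenius_S card_reflected_A card_int)
  ultimately show "\<exists>S :: int set. numerical_semigroup S \<and> far_flung_gorenstein S \<and>
      reduced_type S = t \<and> semigroup_type S = t \<and> residue S > canonical_length S"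
    using numerical_semigroup_S canonical_trace_S by (auto simp: far_flung_gorenstein_def)
qed

end
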